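(* Let $\Delta$ be a natural number and let $r\ge 3$ be an integer. For $j=1,2,\dots$ let $G_j$ be a $K_{1,r}$-free graph on $n_j$ vertices, with $n_j\to\infty$, of maximum degree $\Delta$, in which the number $z_j$ of vertices of degree smaller than $\Delta$ satisfies $z_j=o(n_j)$. (i) If $r\equiv 0\pmod 2$, then $\limsup_{j\to\infty} \alpha_{\mathrm{od}}(G_j)/n_j\le \frac{r-1}{\Delta+r-1}$. (ii) If $r\equiv 1\pmod 2$, then $\limsup_{j\to\infty} \alpha_{\mathrm{od}}(G_j)/n_j\le \frac{r-2}{\Delta+r-2}$.
   Context: Graphs are finite and simple; $N(v)$ is the open neighborhood of $v$. An odd independent set in $G=(V,E)$ is an independent set $S\subseteq V$ such that for every $v\in V\setminus S$, either $N(v)\cap S=\varnothing$ or $|N(v)\cap S|$ is odd. $\alpha_{\mathrm{od}}(G)$ denotes the largest cardinality of an odd independent set in $G$. A graph is $K_{1,r}$-free if it contains no induced subgraph isomorphic to $K_{1,r}$. *)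

theory Defs
  imports
    "Graph_Theory.Kuratowski"
    "HOL-Library.Landau_Symbols"
    "HOL-Library.Extended_Real"
    "HOL-Library.Liminf_Limsup"
begin

text \<open>
  Finite simple graphs are the locale \<^locale>\<open>graph\<close>: finite, loop-free, symmetric digraphs without
  parallel arcs, so that an undirected edge is a pair of opposite arcs.
\<close>

definition neighborhood :: "('a, 'b) pre_digraph \<Rightarrow> 'a \<Rightarrow> 'a set" where
  "neighborhood G v = {u. v \<rightarrow>\<^bsub>G\<^esub> u}"

definition degree :: "('a, 'b) pre_digraph \<Rightarrow> 'a \<Rightarrow> nat" where
  "degree G v = card (neighborhood G v)"

text \<open>Meaningful for graphs with at least one vertex only.\<close>

definition max_degree :: "('a, 'b) pre_digraph \<Rightarrow> nat" where
  "max_degree G = Max (degree G ` verts G)"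

text \<open>\<open>K\<^bsub>1,r\<^esub> H\<close> already says that \<open>H\<close> is isomorphic to the star with \<open>r\<close> leaves.\<close>

definition star_free :: "nat \<Rightarrow> ('a, 'b) pre_digraph \<Rightarrow> bool" where
  "star_free r G \<longleftrightarrow> \<not> (\<exists>H. induced_subgraph H G \<and> K\<^bsub>1,r\<^esub> H)"

definition independent_set :: "('a, 'b) pre_digraph \<Rightarrow> 'a set \<Rightarrow> bool" where
  "independent_set G S \<longleftrightarrow> S \<subseteq> verts G \<and> (\<forall>u\<in>S. \<forall>v\<in>S. \<not> u \<rightarrow>\<^bsub>G\<^esub> v)"

definition odd_independent_set :: "('a, 'b) pre_digraph \<Rightarrow> 'a set \<Rightarrow> bool" where
  "odd_independent_set G S \<longleftrightarrow> independent_set G S \<and>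
     (\<forall>v \<in> verts G - S. neighborhood G v \<inter> S = {} \<or> odd (card (neighborhood G v \<inter> S)))"

definition alpha_od :: "('a, 'b) pre_digraph \<Rightarrow> nat" where
  "alpha_od G = Max (card ` {S. odd_independent_set G S})"

end

theory Submission
  imports Defs
begin

text \<open>
  The proof counts the edges between an odd independent set \<open>S\<close> and its complement in two ways.
  The neighbors in \<open>S\<close> of an outside vertex are pairwise non-adjacent, so in a
  \<open>K\<^bsub>1,r\<^esub>\<close>-free graph there are at most \<open>r - 1\<close> of them, and as a nonzero number of them is odd,
  at most \<open>r - 2\<close> if \<open>r\<close> is odd (\<open>star_free_card_neighbors\<close>).  Write \<open>k\<close> for this bound.
  All neighbors of a vertex of \<open>S\<close> lie outside \<open>S\<close>, so with \<open>z\<close> vertices of degree less than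
  \<open>\<Delta>\<close> the number of edges leaving \<open>S\<close> is at least \<open>\<Delta> (|S| - z)\<close>.  Hence
  \<open>\<Delta> |S| \<le> k (n - |S|) + \<Delta> z\<close> (\<open>independent_set_edge_count\<close>), which gives
  \[ \frac{|S|}{n} \le \frac{k}{\Delta + k} + \frac{\Delta}{\Delta + k} \cdot \frac{z}{n}, \]
  and the last summand tends to \<open>0\<close>.
\<close>

lemma mem_neighborhood [simp]: "u \<in> neighborhood G v \<longleftrightarrow> v \<rightarrow>\<^bsub>G\<^esub> u"
  by (simp add: neighborhood_def)

lemma (in wf_digraph) neighborhood_subset_verts: "neighborhood G v \<subseteq> verts G"
  using adj_in_verts(2) by auto

lemma dominates_induce_subgraph_iff:
  "u \<rightarrow>\<^bsub>G \<restriction> W\<^esub> v \<longleftrightarrow> u \<in> W \<and> v \<in> W \<and> u \<rightarrow>\<^bsub>G\<^esub> v"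
  by (auto simp: arcs_ends_conv)

lemma (in graph) graph_induce_subgraph:
  assumes "W \<subseteq> verts G"
  shows "graph (G \<restriction> W)"
proof -
  have sym: "u \<rightarrow>\<^bsub>G\<^esub> v \<Longrightarrow> v \<rightarrow>\<^bsub>G\<^esub> u" for u v
    using sym_arcs by (rule arcs_ends_symmetric)
  show ?thesis
  proof unfold_locales
    show "finite (verts (G \<restriction> W))"
      using assms by (auto intro: finite_subset)
    show "symmetric (G \<restriction> W)"
      unfolding symmetric_def by (rule symI) (use sym in \<open>auto simp: dominates_induce_subgraph_iff\<close>)
    show "e1 = e2"
      if "e1 \<in> arcs (G \<restriction> W)" "e2 \<in> arcs (G \<restriction> W)"
        "arc_to_ends (G \<restriction> W) e1 = arc_to_ends (G \<restriction> W) e2" for e1 e2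
      using that no_multi_arcs[of e1 e2] by (simp add: arc_to_ends_def)
  qed (auto dest: no_loops)
qed

lemma (in graph) star_induce_subgraph:
  assumes v: "v \<in> verts G" and T: "T \<subseteq> neighborhood G v" and indep: "independent_set G T"
  shows "K\<^bsub>1,card T\<^esub> (G \<restriction> insert v T)"
proof -
  have sym: "x \<rightarrow>\<^bsub>G\<^esub> y \<Longrightarrow> y \<rightarrow>\<^bsub>G\<^esub> x" for x y
    using sym_arcs by (rule arcs_ends_symmetric)
  have "v \<notin> T"
  proof
    assume "v \<in> T"
    with T have "v \<in> neighborhood G v"
      by (rule subsetD)
    then show False
      by (auto dest: adj_not_same)
  qed
  moreover have "T \<subseteq> verts G"
    using indep by (simp add: independent_set_def)
  moreover have "arcs_ends (G \<restriction> insert v T) = {v} \<times> T \<union> T \<times> {v}" (is "?A = ?B")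
  proof -
    have "(x, y) \<in> ?A \<longleftrightarrow> (x, y) \<in> ?B" for x y
      using T indep sym
      by (auto simp: dominates_induce_subgraph_iff independent_set_def dest: adj_not_same)
    then show ?thesis by auto
  qed
  ultimately show ?thesis
    unfolding complete_bipartite_digraph_def
    using v graph_induce_subgraph[of "insert v T"]
    by (intro conjI exI[of _ "{v}"] exI[of _ T]) simp_all
qed

lemma (in graph) star_free_card_independent_neighbors:
  assumes "star_free r G" and v: "v \<in> verts G" and S: "independent_set G S"
  shows "card (neighborhood G v \<inter> S) < r"
proof (rule ccontr)
  assume "\<not> card (neighborhood G v \<inter> S) < r"
  then obtain T where T: "T \<subseteq> neighborhood G v \<inter> S" "card T = r"
    by (meson not_less obtain_subset_with_card_n)
  have "independent_set G T"
    using S T(1) by (meson independent_set_def subset_trans le_inf_iff subsetD)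
  then have "K\<^bsub>1,r\<^esub> (G \<restriction> insert v T)"
    using star_induce_subgraph[OF v, of T] T by auto
  moreover have "induced_subgraph (G \<restriction> insert v T) G"
    using \<open>independent_set G T\<close> v by (intro induced_induce) (auto simp: independent_set_def)
  ultimately show False
    using assms(1) by (auto simp: star_free_def)
qed

lemma (in graph) star_free_card_neighbors:
  assumes "star_free r G" and S: "odd_independent_set G S" and v: "v \<in> verts G - S"
  shows "card (neighborhood G v \<inter> S) \<le> (if even r then r - 1 else r - 2)"
proof -
  have "card (neighborhood G v \<inter> S) < r"
    using star_free_card_independent_neighbors assms by (auto simp: odd_independent_set_def)
  moreover have "card (neighborhood G v \<inter> S) = 0 \<or> odd (card (neighborhood G v \<inter> S))"
    using S v by (metis card.empty odd_independent_set_def)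
  ultimately show ?thesis
    by (auto elim!: evenE oddE)
qed

lemma (in graph) independent_set_edge_count:
  assumes S: "independent_set G S"
    and k: "\<And>v. v \<in> verts G - S \<Longrightarrow> card (neighborhood G v \<inter> S) \<le> k"
  shows "d * card S \<le> k * (card (verts G) - card S) + d * card {v \<in> verts G. degree G v < d}"
proof -
  let ?Z = "{v \<in> verts G. degree G v < d}"
  have sub: "S \<subseteq> verts G"
    using S by (simp add: independent_set_def)
  then have fin: "finite S"
    by (rule finite_subset) simp
  have sym: "u \<rightarrow>\<^bsub>G\<^esub> v \<longleftrightarrow> v \<rightarrow>\<^bsub>G\<^esub> u" for u v
    using sym_arcs arcs_ends_symmetric by metis
  have "d * card S \<le> d * card (S - ?Z) + d * card ?Z"
    using diff_card_le_card_Diff[of ?Z S] le_diff_conv unfolding add_mult_distrib2[symmetric]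
    by (intro mult_le_mono2) simp
  also have "d * card (S - ?Z) \<le> (\<Sum>v\<in>S - ?Z. degree G v)"
  proof -
    have "d \<le> degree G v" if "v \<in> S - ?Z" for v
      using that sub by auto
    from sum_bounded_below[of "S - ?Z" d "degree G", OF this] show ?thesis
      by (simp add: mult.commute)
  qed
  also have "\<dots> \<le> (\<Sum>v\<in>S. degree G v)"
    using fin by (intro sum_mono2) auto
  also have "\<dots> = (\<Sum>v\<in>S. \<Sum>u | u \<in> verts G - S \<and> v \<rightarrow>\<^bsub>G\<^esub> u. 1)"
  proof (rule sum.cong[OF refl])
    fix v assume "v \<in> S"
    then have "neighborhood G v = {u \<in> verts G - S. v \<rightarrow>\<^bsub>G\<^esub> u}"
      using S neighborhood_subset_verts[of v] by (auto simp: independent_set_def)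
    then show "degree G v = (\<Sum>u | u \<in> verts G - S \<and> v \<rightarrow>\<^bsub>G\<^esub> u. 1)"
      by (simp add: degree_def)
  qed
  \<comment> \<open>Double counting: the edges leaving \<open>S\<close> are now sorted by their outer end.\<close>
  also have "\<dots> = (\<Sum>u\<in>verts G - S. \<Sum>v | v \<in> S \<and> v \<rightarrow>\<^bsub>G\<^esub> u. 1)"
    using fin by (intro sum.swap_restrict) auto
  also have "\<dots> = (\<Sum>u\<in>verts G - S. card (neighborhood G u \<inter> S))"
  proof (rule sum.cong[OF refl])
    fix u
    have "{v \<in> S. v \<rightarrow>\<^bsub>G\<^esub> u} = neighborhood G u \<inter> S"
      using sym by auto
    then show "(\<Sum>v | v \<in> S \<and> v \<rightarrow>\<^bsub>G\<^esub> u. 1) = card (neighborhood G u \<inter> S)"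
      by simp
  qed
  also have "\<dots> \<le> card (verts G - S) * k"
    using sum_bounded_above[of "verts G - S" "\<lambda>u. card (neighborhood G u \<inter> S)" k] k by simp
  also have "card (verts G - S) = card (verts G) - card S"
    using fin sub by (rule card_Diff_subset)
  finally show ?thesis by (simp add: mult.commute)
qed

lemma (in graph) alpha_od_attained:
  obtains S where "odd_independent_set G S" "card S = alpha_od G"
proof -
  have "{S. odd_independent_set G S} \<subseteq> Pow (verts G)"
    by (auto simp: odd_independent_set_def independent_set_def)
  then have "finite {S. odd_independent_set G S}"
    by (rule finite_subset) simp
  moreover have "odd_independent_set G {}"
    by (simp add: odd_independent_set_def independent_set_def)
  ultimately have "alpha_od G \<in> card ` {S. odd_independent_set G S}"
    unfolding alpha_od_def by (intro Max_in) auto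
  then show ?thesis using that by auto
qed

text \<open>
  This holds for every \<open>d\<close>, without reference to the maximum degree: it only becomes weak when
  many vertices have degree below \<open>d\<close>.
\<close>

lemma (in graph) alpha_od_ratio_le:
  assumes free: "star_free r G" and r: "r \<ge> 3" and nonempty: "verts G \<noteq> {}"
    and k: "k = (if even r then r - 1 else r - 2)"
  shows "real (alpha_od G) / real (card (verts G)) \<le> real k / (real d + real k) +
    real d / (real d + real k) *
      (real (card {v \<in> verts G. degree G v < d}) / real (card (verts G)))"
proof -
  define n where "n = card (verts G)"
  define z where "z = card {v \<in> verts G. degree G v < d}"
  obtain S where S: "odd_independent_set G S" "card S = alpha_od G"
    by (rule alpha_od_attained)
  have indep: "independent_set G S"
    using S(1) by (simp add: odd_independent_set_def)
  have "card S \<le> n"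
    unfolding n_def using indep by (intro card_mono) (auto simp: independent_set_def)
  have "d * card S \<le> k * (n - card S) + d * z"
    unfolding n_def z_def k
    using indep star_free_card_neighbors[OF free S(1)] by (rule independent_set_edge_count)
  then have "real (d * card S) \<le> real (k * (n - card S) + d * z)"
    by (simp only: of_nat_le_iff)
  then have "real d * real (card S) \<le> real k * (real n - real (card S)) + real d * real z"
    using \<open>card S \<le> n\<close> by simp
  then have le: "real (card S) * (real d + real k) \<le> real k * real n + real d * real z"
    by (simp add: algebra_simps)
  \<comment> \<open>The denominator is positive even for \<open>d = 0\<close>, because \<open>r \<ge> 3\<close> makes \<open>k \<ge> 1\<close>.\<close>
  have pos: "real d + real k > 0" "real n > 0"
    using k r nonempty by (auto simp: n_def card_gt_0_iff)
  then have "real (card S) / real n \<le> (real k * real n + real d * real z) / (real d + real k) / real n"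
    using le by (intro divide_right_mono) (auto simp: pos_le_divide_eq)
  also have "\<dots> = real k / (real d + real k) + real d / (real d + real k) * (real z / real n)"
    using pos(2) by (simp add: add_divide_distrib)
  finally show ?thesis
    by (simp add: S(2) n_def z_def)
qed

theorem proposition3:
  fixes \<Delta> r :: nat
    and G :: "nat \<Rightarrow> ('a, 'b) pre_digraph"
    and n z :: "nat \<Rightarrow> nat"
  assumes r: "r \<ge> 3"
    and graph: "\<And>j. j \<ge> 1 \<Longrightarrow> graph (G j)"
    and star_free: "\<And>j. j \<ge> 1 \<Longrightarrow> star_free r (G j)"
    and n: "\<And>j. j \<ge> 1 \<Longrightarrow> n j = card (verts (G j))"
    and n_tendsto: "filterlim n at_top sequentially"
    and max_degree: "\<And>j. j \<ge> 1 \<Longrightarrow> max_degree (G j) = \<Delta>"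
    and z: "\<And>j. j \<ge> 1 \<Longrightarrow> z j = card {v \<in> verts (G j). degree (G j) v < \<Delta>}"
    and z_small: "(\<lambda>j. real (z j)) \<in> o(\<lambda>j. real (n j))"
  shows "(even r \<longrightarrow>
           limsup (\<lambda>j. ereal (real (alpha_od (G j)) / real (n j)))
             \<le> ereal ((real r - 1) / (real \<Delta> + real r - 1))) \<and>
         (odd r \<longrightarrow>
           limsup (\<lambda>j. ereal (real (alpha_od (G j)) / real (n j)))
             \<le> ereal ((real r - 2) / (real \<Delta> + real r - 2)))"
proof -
  define k where "k = (if even r then r - 1 else r - 2)"
  let ?a = "real k / (real \<Delta> + real k)" and ?b = "real \<Delta> / (real \<Delta> + real k)"
  have "(\<lambda>j. real (z j) / real (n j)) \<longlonglongrightarrow> 0"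
    using z_small by (rule smalloD_tendsto)
  then have "(\<lambda>j. ?a + ?b * (real (z j) / real (n j))) \<longlonglongrightarrow> ?a + ?b * 0"
    by (intro tendsto_intros)
  then have lim: "(\<lambda>j. ereal (?a + ?b * (real (z j) / real (n j)))) \<longlonglongrightarrow> ereal ?a"
    by simp
  have "eventually (\<lambda>j. n j \<ge> 1) sequentially"
    using n_tendsto by (simp add: filterlim_at_top)
  then have "eventually (\<lambda>j. ereal (real (alpha_od (G j)) / real (n j))
      \<le> ereal (?a + ?b * (real (z j) / real (n j)))) sequentially"
    using eventually_ge_at_top[of 1]
  proof eventually_elim
    case (elim j)
    interpret graph "G j"
      using graph elim(2) .
    have "verts (G j) \<noteq> {}"
      using elim n[of j] by auto
    then show ?case
      using alpha_od_ratio_le[OF star_free[OF elim(2)] r _ k_def, of \<Delta>] n[OF elim(2)] z[OF elim(2)]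
      by simp
  qed
  then have "limsup (\<lambda>j. ereal (real (alpha_od (G j)) / real (n j)))
      \<le> limsup (\<lambda>j. ereal (?a + ?b * (real (z j) / real (n j))))"
    by (rule Limsup_mono)
  also have "\<dots> = ereal ?a"
    using lim by (intro lim_imp_Limsup) simp_all
  finally have "limsup (\<lambda>j. ereal (real (alpha_od (G j)) / real (n j))) \<le> ereal ?a" .
  moreover have "even r \<Longrightarrow> real k = real r - 1" "odd r \<Longrightarrow> real k = real r - 2"
    using r by (auto simp: k_def)
  ultimately show ?thesis
    by (auto simp: add_diff_eq)
qed

end
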